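(* Let $n\ge3$ be an integer and $m\ge4$ an even integer with $(n,m)\ne(3,4)$, and consider the problem of maximizing $f(\mathbf u)=\sum_{i=1}^n u_i^m$ over $\mathbf u\in\mathbb R^n$ subject to $\mathbf u^{\mathrm T}\mathbf u=1$ and $\mathbf u^{\mathrm T}\mathbf 1_n=0$. Consider the stationary points of the form $\mathbf u=\mathbf P[c\mathbf 1_p^{\mathrm T},\,d\mathbf 1_q^{\mathrm T},\,e\mathbf 1_s^{\mathrm T}]^{\mathrm T}$, where $\mathbf P$ is an $n\times n$ permutation matrix, $1\le p,q,s\le n-1$, $p+q+s=n$, and $c,d,e$ are real numbers with $e<d<c$. Then, except in the case $q=1$, all these stationary points are saddle points of the problem. If $q=1$, the corresponding stationary point is not a local maximum point of the problem.
   Context: $\mathbf 1_k$ denotes the all-ones column vector of length $k$. A stationary point of the problem is a real $\mathbf u$ satisfying both constraints for which there exist real Lagrange multipliers $\alpha,\beta$ with $u_i^{m-1}-\alpha u_i-\beta=0$ for all $i$. Local maximum (minimum) points are understood relative to the feasible set $\{\mathbf u:\mathbf u^{\mathrm T}\mathbf u=1,\ \mathbf u^{\mathrm T}\mathbf 1_n=0\}$; a saddle point is a stationary point that is neither a local maximum nor a local minimum of $f$ on the feasible set. *)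

theory Defs
  imports "HOL-Analysis.Analysis"
begin

definition objective :: "nat \<Rightarrow> real ^ 'n::finite \<Rightarrow> real" where
  "objective m u = (\<Sum>i\<in>UNIV. (u $ i) ^ m)"

definition feasible :: "(real ^ 'n::finite) set" where
  "feasible = {u. u \<bullet> u = 1 \<and> u \<bullet> vec 1 = 0}"

text \<open>The constant factors coming from differentiating the Lagrangian are absorbed in the
  multipliers \<open>\<alpha>\<close> and \<open>\<beta>\<close>.\<close>

definition stationary_point :: "nat \<Rightarrow> real ^ 'n::finite \<Rightarrow> bool" where
  "stationary_point m u \<longleftrightarrow>
     u \<in> feasible \<and> (\<exists>\<alpha> \<beta>. \<forall>i. (u $ i) ^ (m - 1) - \<alpha> * u $ i - \<beta> = 0)"

definition local_max_on :: "'a::metric_space set \<Rightarrow> ('a \<Rightarrow> real) \<Rightarrow> 'a \<Rightarrow> bool" where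
  "local_max_on S f u \<longleftrightarrow> u \<in> S \<and> (\<exists>\<epsilon>>0. \<forall>v\<in>S. dist v u < \<epsilon> \<longrightarrow> f v \<le> f u)"

definition local_min_on :: "'a::metric_space set \<Rightarrow> ('a \<Rightarrow> real) \<Rightarrow> 'a \<Rightarrow> bool" where
  "local_min_on S f u \<longleftrightarrow> u \<in> S \<and> (\<exists>\<epsilon>>0. \<forall>v\<in>S. dist v u < \<epsilon> \<longrightarrow> f u \<le> f v)"

definition saddle_point :: "nat \<Rightarrow> real ^ 'n::finite \<Rightarrow> bool" where
  "saddle_point m u \<longleftrightarrow> stationary_point m u \<and>
     \<not> local_max_on feasible (objective m) u \<and> \<not> local_min_on feasible (objective m) u"

definition permutation_matrix :: "real ^ 'n ^ 'n::finite \<Rightarrow> bool" where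
  "permutation_matrix P \<longleftrightarrow>
     (\<exists>\<pi>. \<pi> permutes UNIV \<and> P = (\<chi> i j. if i = \<pi> j then 1 else 0))"

text \<open>A finite index type carries no order, so writing a vector as consecutive blocks needs a
  numbering \<open>idx\<close> of the coordinates by \<open>1, \<dots>, n\<close>. With such a numbering,
  \<open>block_vector idx p q c d e\<close> has the value \<open>c\<close> in its first \<open>p\<close> coordinates, \<open>d\<close> in the
  next \<open>q\<close>, and \<open>e\<close> in all remaining ones.\<close>

definition block_vector ::
  "('n::finite \<Rightarrow> nat) \<Rightarrow> nat \<Rightarrow> nat \<Rightarrow> real \<Rightarrow> real \<Rightarrow> real \<Rightarrow> real ^ 'n" where
  "block_vector idx p q c d e =
     (\<chi> i. if idx i \<le> p then c else if idx i \<le> p + q then d else e)"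

end

theory Submission
  imports Defs "HOL-Computational_Algebra.Polynomial"
begin

text \<open>
  At a stationary point every coordinate is a root of
  \<open>g x = x ^ (m - 1) - \<alpha> * x - \<beta>\<close>, and the second derivative of the objective along a feasible
  curve leaving \<open>u\<close> in a tangent direction \<open>v\<close> is, up to the factor \<open>m\<close>, the sum over \<open>i\<close> of
  \<open>g' (u $ i) * (v $ i)\<^sup>2\<close>. So everything is decided by the slopes of \<open>g\<close> at its three roots
  (\<open>second_order_test\<close>).

  Since \<open>m\<close> is even, \<open>g'\<close> is even with exactly two zeros \<open>-z < z\<close>, one in each gap between
  the roots; hence \<open>g'\<close> is positive at \<open>c\<close> and \<open>e\<close> and negative at \<open>d\<close>
  (\<open>three_roots_slope_signs\<close>). A value taken at two coordinates allows the direction that raises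
  one of them and lowers the other, and only the slope at that value then matters
  (\<open>repeated_value_test\<close>). This excludes a minimum when \<open>d\<close> is repeated and a maximum when
  \<open>c\<close> or \<open>e\<close> is.

  There remains a possible maximum with \<open>c\<close> and \<open>e\<close> simple and \<open>d\<close> taken \<open>q\<close> times. Up to scaling
  there is one tangent direction that is constant on the \<open>d\<close>-block, and along it the
  quadratic form is
  \<open>g' c * (d - e)\<^sup>2 + g' d * (c - e)\<^sup>2 / q + g' e * (c - d)\<^sup>2\<close>. For \<open>q = 1\<close> this is
  \<open>((c - d) * (d - e) * (c - e))\<^sup>2\<close> times the divided difference of \<open>x ^ (m - 1)\<close> over the nodes
  \<open>c, c, d, d, e, e\<close>, that is, times the leading coefficient of its quintic Hermite interpolant.
  That coefficient vanishes for \<open>m = 4\<close>, and iterating Rolle's theorem shows it to be positive for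
  \<open>m \<ge> 6\<close> (\<open>three_roots_slope_form_pos\<close>). As \<open>g' d\<close> is negative, a larger \<open>q\<close> increases the form,
  strictly so. Hence it is positive except for \<open>q = 1\<close>, \<open>m = 4\<close>, which is the case \<open>n = 3\<close>, \<open>m = 4\<close>
  in which the objective is constant on the feasible circle.
\<close>

section \<open>The second-order test\<close>

text \<open>The derivative of the function \<open>g\<close> above.\<close>

definition multiplier_slope :: "nat \<Rightarrow> real \<Rightarrow> real \<Rightarrow> real" where
  "multiplier_slope m \<alpha> x = real (m - 1) * x ^ (m - 2) - \<alpha>"

lemma pos_right_of_convex_critical_zero:
  fixes \<phi> \<phi>' :: "real \<Rightarrow> real"
  assumes der: "\<And>t. (\<phi> has_real_derivative \<phi>' t) (at t)"
    and der2: "(\<phi>' has_real_derivative D) (at 0)"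
    and "\<phi> 0 = 0" "\<phi>' 0 = 0" "D > 0"
  shows "\<forall>\<^sub>F t in at_right 0. \<phi> t > 0"
proof -
  obtain \<delta> where \<delta>: "\<delta> > 0" "\<And>h. 0 < h \<Longrightarrow> h < \<delta> \<Longrightarrow> \<phi>' 0 < \<phi>' (0 + h)"
    using DERIV_pos_inc_right[OF der2 \<open>D > 0\<close>] by blast
  have "\<phi> t > 0" if t: "0 < t" "t < \<delta>" for t
  proof -
    obtain z where z: "0 < z" "z < t" "\<phi> t - \<phi> 0 = (t - 0) * \<phi>' z"
      using MVT2[OF t(1)] der by blast
    have "\<phi>' z > 0"
      using \<delta>(2)[of z] z t assms by simp
    then show ?thesis
      using z t assms by simp
  qed
  then show ?thesis
    using \<delta>(1) by (auto simp: eventually_at_right_field)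
qed

text \<open>Multiplying the stationarity equation by \<open>u $ i\<close> and summing, the two constraints leave
  only the multiplier \<open>\<alpha>\<close>.\<close>

lemma multiplier_eq_objective:
  fixes u :: "real ^ 'n::finite"
  assumes "u \<in> feasible" "m > 0"
    and stat: "\<And>i. (u $ i) ^ (m - 1) - \<alpha> * u $ i - \<beta> = 0"
  shows "\<alpha> = objective m u"
proof -
  have uu: "(\<Sum>i\<in>UNIV. u $ i * u $ i) = 1" and u1: "(\<Sum>i\<in>UNIV. u $ i) = 0"
    using assms(1) by (auto simp: feasible_def inner_vec_def)
  have "(u $ i) ^ m = \<alpha> * (u $ i * u $ i) + \<beta> * u $ i" for i
  proof -
    have "(u $ i) ^ m = (u $ i) ^ (m - 1) * u $ i"
      using \<open>m > 0\<close> by (metis power_minus_mult)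
    also have "(u $ i) ^ (m - 1) = \<alpha> * u $ i + \<beta>"
      using stat[of i] by simp
    finally show ?thesis by (simp add: algebra_simps)
  qed
  then have "objective m u = \<alpha> * (\<Sum>i\<in>UNIV. u $ i * u $ i) + \<beta> * (\<Sum>i\<in>UNIV. u $ i)"
    by (simp add: objective_def sum.distrib sum_distrib_left)
  with uu u1 show ?thesis by simp
qed

text \<open>For \<open>u\<close> a unit vector orthogonal to \<open>v\<close>, the factor is the inverse length of \<open>u + t v\<close>, so
  this is a curve on the unit sphere with velocity \<open>v\<close> at \<open>t = 0\<close>.\<close>

definition normalized_ray :: "real ^ 'n::finite \<Rightarrow> real ^ 'n \<Rightarrow> real \<Rightarrow> real ^ 'n" where
  "normalized_ray u v t = (1 / sqrt (1 + t\<^sup>2 * (v \<bullet> v))) *\<^sub>R (u + t *\<^sub>R v)"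

lemma normalized_ray_feasible:
  fixes u v :: "real ^ 'n::finite"
  assumes "u \<in> feasible" "v \<bullet> u = 0" "v \<bullet> vec 1 = 0"
  shows "normalized_ray u v t \<in> feasible"
proof -
  let ?N = "1 + t\<^sup>2 * (v \<bullet> v)"
  have N: "?N > 0"
    by (smt (verit) inner_ge_zero mult_nonneg_nonneg zero_le_power2)
  have "(u + t *\<^sub>R v) \<bullet> (u + t *\<^sub>R v) = ?N"
    using assms
    by (simp add: feasible_def inner_add_left inner_add_right inner_commute power2_eq_square)
  then have "normalized_ray u v t \<bullet> normalized_ray u v t = 1"
    using N by (simp add: normalized_ray_def)
  moreover have "normalized_ray u v t \<bullet> vec 1 = 0"
    using assms by (simp add: normalized_ray_def feasible_def inner_add_left)
  ultimately show ?thesis by (simp add: feasible_def)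
qed

lemma normalized_ray_tendsto: "(normalized_ray u v \<longlongrightarrow> u) (at_right 0)"
proof -
  have "((\<lambda>t. (1 / sqrt (1 + t\<^sup>2 * (v \<bullet> v))) *\<^sub>R (u + t *\<^sub>R v)) \<longlongrightarrow>
      (1 / sqrt (1 + 0\<^sup>2 * (v \<bullet> v))) *\<^sub>R (u + 0 *\<^sub>R v)) (at_right 0)"
    by (intro tendsto_intros) auto
  then show ?thesis by (simp add: normalized_ray_def[abs_def])
qed

text \<open>For even \<open>m\<close> clearing the normalization turns the objective along the curve into a polynomial
  in \<open>t\<close>, free of square roots.\<close>

lemma objective_normalized_ray:
  fixes u v :: "real ^ 'n::finite"
  assumes "even m"
  shows "objective m (normalized_ray u v t) * (1 + t\<^sup>2 * (v \<bullet> v)) ^ (m div 2)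
    = (\<Sum>i\<in>UNIV. (u $ i + t * v $ i) ^ m)"
proof -
  let ?N = "1 + t\<^sup>2 * (v \<bullet> v)"
  have N: "?N > 0"
    by (smt (verit) inner_ge_zero mult_nonneg_nonneg zero_le_power2)
  have "?N ^ (m div 2) = sqrt ?N ^ m"
    using assms N
    by (metis (no_types, lifting) dvd_mult_div_cancel less_imp_le power_mult real_sqrt_pow2)
  moreover have "sqrt ?N > 0" using N by simp
  ultimately show ?thesis
    by (simp add: objective_def normalized_ray_def power_divide sum_distrib_right)
qed

text \<open>The change of the objective along the normalized ray, multiplied by a positive factor, is the
  polynomial \<open>\<phi>\<close> in \<open>t\<close>. It vanishes to second order at \<open>0\<close> by stationarity, and because
  \<open>\<alpha>\<close> is the value of the objective its second derivative there is \<open>m * Q\<close>.\<close>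

lemma second_order_test:
  fixes u v :: "real ^ 'n::finite"
  assumes feas: "u \<in> feasible" and m: "m \<ge> 2" "even m"
    and stat: "\<And>i. (u $ i) ^ (m - 1) - \<alpha> * u $ i - \<beta> = 0"
    and vu: "v \<bullet> u = 0" and v1: "v \<bullet> vec 1 = 0"
    and Q_def: "Q = (\<Sum>i\<in>UNIV. multiplier_slope m \<alpha> (u $ i) * (v $ i)\<^sup>2)"
  shows "Q > 0 \<Longrightarrow> \<not> local_max_on feasible (objective m) u"
    and "Q < 0 \<Longrightarrow> \<not> local_min_on feasible (objective m) u"
proof -
  define k where "k = m div 2"
  define N where "N t = 1 + t\<^sup>2 * (v \<bullet> v)" for t :: real
  define \<phi> where "\<phi> t = (\<Sum>i\<in>UNIV. (u $ i + t * v $ i) ^ m) - \<alpha> * N t ^ k" for t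
  define \<phi>' where "\<phi>' t = (\<Sum>i\<in>UNIV. real m * (u $ i + t * v $ i) ^ (m - 1) * v $ i)
    - t * (\<alpha> * (real m * N t ^ (k - 1) * (v \<bullet> v)))" for t
  have k: "real m = 2 * real k"
    using m by (auto simp: k_def elim!: evenE)
  have N_pos: "N t > 0" for t
    unfolding N_def by (smt (verit) inner_ge_zero mult_nonneg_nonneg zero_le_power2)
  have \<alpha>: "\<alpha> = objective m u"
    using multiplier_eq_objective[OF feas _ stat] m by simp
  have vv: "(\<Sum>i\<in>UNIV. (v $ i)\<^sup>2) = v \<bullet> v"
    by (simp add: inner_vec_def power2_eq_square)
  have der: "(\<phi> has_real_derivative \<phi>' t) (at t)" for t
  proof -
    have "((\<lambda>t. \<Sum>i\<in>UNIV. (u $ i + t * v $ i) ^ m) has_real_derivative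
        (\<Sum>i\<in>UNIV. real m * (u $ i + t * v $ i) ^ (m - 1) * v $ i)) (at t)"
      by (auto intro!: derivative_eq_intros sum.cong)
    moreover have "(N has_real_derivative 2 * t * (v \<bullet> v)) (at t)"
      unfolding N_def by (auto intro!: derivative_eq_intros)
    from DERIV_cmult[OF DERIV_power[OF this, of k], of \<alpha>]
    have "((\<lambda>t. \<alpha> * N t ^ k) has_real_derivative
        t * (\<alpha> * (real m * N t ^ (k - 1) * (v \<bullet> v)))) (at t)"
      by (rule DERIV_cong) (simp add: k)
    ultimately show ?thesis
      unfolding \<phi>_def \<phi>'_def by (rule DERIV_diff)
  qed
  have "((\<lambda>t. \<alpha> * (real m * N t ^ (k - 1) * (v \<bullet> v))) has_real_derivative
      \<alpha> * (real m * (real (k - 1) * (0 * 1) * N 0 ^ (k - 2)) * (v \<bullet> v))) (at 0)"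
    unfolding N_def by (auto intro!: derivative_eq_intros)
  note DERIV_mult[OF DERIV_ident this]
  then have "((\<lambda>t. t * (\<alpha> * (real m * N t ^ (k - 1) * (v \<bullet> v)))) has_real_derivative
      \<alpha> * (real m * (v \<bullet> v))) (at 0)"
    by (simp add: N_def)
  moreover have "((\<lambda>t. \<Sum>i\<in>UNIV. real m * (u $ i + t * v $ i) ^ (m - 1) * v $ i)
      has_real_derivative (\<Sum>i\<in>UNIV. real m * (real (m - 1) * (u $ i) ^ (m - 2)) * (v $ i)\<^sup>2)) (at 0)"
    by (auto intro!: derivative_eq_intros sum.cong
        simp: power2_eq_square numeral_2_eq_2 algebra_simps)
  ultimately have "(\<phi>' has_real_derivative
      (\<Sum>i\<in>UNIV. real m * (real (m - 1) * (u $ i) ^ (m - 2)) * (v $ i)\<^sup>2)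
        - \<alpha> * (real m * (v \<bullet> v))) (at 0)"
    unfolding \<phi>'_def by (intro DERIV_diff)
  also have "(\<Sum>i\<in>UNIV. real m * (real (m - 1) * (u $ i) ^ (m - 2)) * (v $ i)\<^sup>2)
        - \<alpha> * (real m * (v \<bullet> v)) = real m * Q"
    by (simp add: Q_def multiplier_slope_def vv[symmetric] sum_distrib_left
        sum_subtractf[symmetric] algebra_simps)
  finally have der2: "(\<phi>' has_real_derivative real m * Q) (at 0)" .
  have \<phi>0: "\<phi> 0 = 0"
    by (simp add: \<phi>_def N_def \<alpha> objective_def)
  have "(\<Sum>i\<in>UNIV. real m * (u $ i) ^ (m - 1) * v $ i)
      = real m * (\<Sum>i\<in>UNIV. (\<alpha> * u $ i + \<beta>) * v $ i)"
    using stat by (simp add: sum_distrib_left mult.assoc algebra_simps)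
  also have "(\<Sum>i\<in>UNIV. (\<alpha> * u $ i + \<beta>) * v $ i) = \<alpha> * (v \<bullet> u) + \<beta> * (v \<bullet> vec 1)"
    by (simp add: inner_vec_def sum_distrib_left sum.distrib[symmetric] algebra_simps)
  finally have \<phi>'0: "\<phi>' 0 = 0"
    using vu v1 by (simp add: \<phi>'_def)
  have \<phi>: "\<phi> t = (objective m (normalized_ray u v t) - objective m u) * N t ^ k" for t
    using objective_normalized_ray[OF m(2), of u v t]
    by (simp add: \<phi>_def \<alpha> N_def k_def algebra_simps)
  have near: "\<forall>\<^sub>F t in at_right 0. dist (normalized_ray u v t) u < \<epsilon>" if "\<epsilon> > 0" for \<epsilon>
    using tendstoD[OF normalized_ray_tendsto that] .
  have nontriv: "at_right (0::real) \<noteq> bot" by simp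
  show "\<not> local_max_on feasible (objective m) u" if "Q > 0"
  proof
    assume "local_max_on feasible (objective m) u"
    then obtain \<epsilon> where \<epsilon>: "\<epsilon> > 0"
      "\<And>w. w \<in> feasible \<Longrightarrow> dist w u < \<epsilon> \<Longrightarrow> objective m w \<le> objective m u"
      by (auto simp: local_max_on_def)
    have "\<forall>\<^sub>F t in at_right 0. \<phi> t > 0"
      using pos_right_of_convex_critical_zero[OF der der2 \<phi>0 \<phi>'0] that m by simp
    then have "\<forall>\<^sub>F t in at_right 0. \<phi> t > 0 \<and> dist (normalized_ray u v t) u < \<epsilon>"
      using near[OF \<epsilon>(1)] by eventually_elim simp
    then obtain t where "\<phi> t > 0" "dist (normalized_ray u v t) u < \<epsilon>"
      using eventually_happens nontriv by blast
    then show False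
      using \<epsilon>(2) normalized_ray_feasible[OF feas vu v1, of t] N_pos[of t] \<phi>[of t]
      by (smt (verit) mult_nonpos_nonneg zero_le_power)
  qed
  show "\<not> local_min_on feasible (objective m) u" if "Q < 0"
  proof
    assume "local_min_on feasible (objective m) u"
    then obtain \<epsilon> where \<epsilon>: "\<epsilon> > 0"
      "\<And>w. w \<in> feasible \<Longrightarrow> dist w u < \<epsilon> \<Longrightarrow> objective m u \<le> objective m w"
      by (auto simp: local_min_on_def)
    have "\<forall>\<^sub>F t in at_right 0. - \<phi> t > 0"
      using \<phi>0 \<phi>'0 that m
      by (intro pos_right_of_convex_critical_zero[OF DERIV_minus[OF der] DERIV_minus[OF der2]])
        (simp_all add: mult_less_0_iff)
    then have "\<forall>\<^sub>F t in at_right 0. \<phi> t < 0 \<and> dist (normalized_ray u v t) u < \<epsilon>"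
      using near[OF \<epsilon>(1)] by eventually_elim simp
    then obtain t where "\<phi> t < 0" "dist (normalized_ray u v t) u < \<epsilon>"
      using eventually_happens nontriv by blast
    then show False
      using \<epsilon>(2) normalized_ray_feasible[OF feas vu v1, of t] N_pos[of t] \<phi>[of t]
      by (smt (verit) mult_nonneg_nonneg zero_le_power)
  qed
qed

text \<open>If \<open>u\<close> agrees at \<open>i\<close> and \<open>j\<close>, then \<open>axis i 1 - axis j 1\<close> is orthogonal to both \<open>u\<close> and the
  all-ones vector.\<close>

lemma repeated_value_test:
  fixes u :: "real ^ 'n::finite"
  assumes "u \<in> feasible" "m \<ge> 2" "even m"
    and "\<And>i. (u $ i) ^ (m - 1) - \<alpha> * u $ i - \<beta> = 0"
    and rep: "card {i. u $ i = x} \<ge> 2"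
  shows "multiplier_slope m \<alpha> x > 0 \<Longrightarrow> \<not> local_max_on feasible (objective m) u"
    and "multiplier_slope m \<alpha> x < 0 \<Longrightarrow> \<not> local_min_on feasible (objective m) u"
proof -
  have "\<not> card {i. u $ i = x} \<le> Suc 0" using rep by simp
  then obtain i j where ij: "u $ i = x" "u $ j = x" "i \<noteq> j"
    by (metis (mono_tags) card_le_Suc0_iff_eq finite mem_Collect_eq)
  define v :: "real ^ 'n" where "v = axis i 1 - axis j 1"
  have "(\<Sum>k\<in>UNIV. multiplier_slope m \<alpha> (u $ k) * (v $ k)\<^sup>2)
      = (\<Sum>k\<in>{i, j}. multiplier_slope m \<alpha> (u $ k) * (v $ k)\<^sup>2)"
    by (intro sum.mono_neutral_right) (auto simp: v_def axis_def)
  also have "\<dots> = 2 * multiplier_slope m \<alpha> x"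
    using ij by (simp add: v_def axis_def)
  finally have Q: "2 * multiplier_slope m \<alpha> x
      = (\<Sum>k\<in>UNIV. multiplier_slope m \<alpha> (u $ k) * (v $ k)\<^sup>2)" by simp
  have v: "v \<bullet> u = 0" "v \<bullet> vec 1 = 0"
    using ij by (simp_all add: v_def inner_diff_left inner_axis')
  note test = second_order_test[OF assms(1-4) v Q]
  show "multiplier_slope m \<alpha> x > 0 \<Longrightarrow> \<not> local_max_on feasible (objective m) u"
    and "multiplier_slope m \<alpha> x < 0 \<Longrightarrow> \<not> local_min_on feasible (objective m) u"
    using test by auto
qed

section \<open>Iterated Rolle and quintic Hermite interpolation\<close>

lemma poly_rolle:
  fixes p :: "real poly"
  assumes "a < b" "poly p a = 0" "poly p b = 0"
  shows "\<exists>z. a < z \<and> z < b \<and> poly (pderiv p) z = 0"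
  using poly_MVT[OF assms(1), of p] assms by auto

lemma poly_rolle_iterated:
  fixes p :: "real poly"
  assumes "\<And>i. i < n \<Longrightarrow> x i < x (Suc i)" "\<And>i. i \<le> n \<Longrightarrow> poly p (x i) = 0" "j \<le> n"
  shows "\<exists>y. (\<forall>i < n - j. y i < y (Suc i)) \<and> (\<forall>i \<le> n - j. poly ((pderiv ^^ j) p) (y i) = 0)"
  using assms(3)
proof (induction j)
  case 0
  then show ?case using assms by auto
next
  case (Suc j)
  then obtain y where y: "\<And>i. i < n - j \<Longrightarrow> y i < y (Suc i)"
      "\<And>i. i \<le> n - j \<Longrightarrow> poly ((pderiv ^^ j) p) (y i) = 0"
    by auto
  have "\<exists>z. y i < z \<and> z < y (Suc i) \<and> poly ((pderiv ^^ Suc j) p) z = 0" if "i < n - j" for i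
    using poly_rolle[of "y i" "y (Suc i)" "(pderiv ^^ j) p"] y that by simp
  then obtain z where z: "\<And>i. i < n - j \<Longrightarrow> y i < z i \<and> z i < y (Suc i)
      \<and> poly ((pderiv ^^ Suc j) p) (z i) = 0"
    by metis
  show ?case
  proof (intro exI[of _ z] conjI allI impI)
    fix i assume "i < n - Suc j"
    then show "z i < z (Suc i)"
      using z[of i] z[of "Suc i"] by linarith
  next
    fix i assume "i \<le> n - Suc j"
    then show "poly ((pderiv ^^ Suc j) p) (z i) = 0"
      using z[of i] Suc.prems by simp
  qed
qed

text \<open>The difference \<open>G\<close> of \<open>x ^ k\<close> and its Hermite interpolant has double zeros at the three nodes,
  so \<open>G'\<close> has five zeros: the nodes and one point in each gap. Iterated Rolle gives two zeros of the
  fourth derivative, which is \<open>C * x ^ (k - 4)\<close> minus a linear function with slope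
  \<open>120 * coeff p 5\<close>. As \<open>k - 4\<close> is odd, this would be strictly increasing if the coefficient were
  not positive. Stopping at the fourth derivative keeps the inequality strict: the fifth derivative
  gives only \<open>120 * coeff p 5 = (k - 4) * C * \<xi> ^ (k - 5)\<close>, and \<open>\<xi>\<close> may be \<open>0\<close>.\<close>

lemma quintic_hermite_lead_coeff_pos:
  fixes p :: "real poly"
  assumes k: "odd k" "k \<ge> 5" and ord: "e < d" "d < c" and deg: "degree p \<le> 5"
    and val: "\<And>x. x \<in> {c, d, e} \<Longrightarrow> poly p x = x ^ k"
    and slope: "\<And>x. x \<in> {c, d, e} \<Longrightarrow> poly (pderiv p) x = real k * x ^ (k - 1)"
  shows "coeff p 5 > 0"
proof (rule ccontr)
  assume "\<not> coeff p 5 > 0"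
  then have neg: "coeff p 5 \<le> 0" by simp
  define G where "G = monom 1 k - p"
  have G: "poly G x = 0" "poly (pderiv G) x = 0" if "x \<in> {c, d, e}" for x
    using val[OF that] slope[OF that]
    by (simp_all add: G_def poly_monom pderiv_diff pderiv_monom)
  obtain z1 where z1: "e < z1" "z1 < d" "poly (pderiv G) z1 = 0"
    using poly_rolle[OF ord(1), of G] G by auto
  obtain z2 where z2: "d < z2" "z2 < c" "poly (pderiv G) z2 = 0"
    using poly_rolle[OF ord(2), of G] G by auto
  have less4: "i < 4 \<longleftrightarrow> i = 0 \<or> i = 1 \<or> i = 2 \<or> i = 3" for i :: nat by auto
  have le4: "i \<le> 4 \<longleftrightarrow> i = 0 \<or> i = 1 \<or> i = 2 \<or> i = 3 \<or> i = 4" for i :: nat by auto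
  let ?x = "\<lambda>i. [e, z1, d, z2, c] ! i"
  have "\<exists>y. (\<forall>i < 4 - 3. y i < y (Suc i)) \<and>
      (\<forall>i \<le> 4 - 3. poly ((pderiv ^^ 3) (pderiv G)) (y i) = 0)"
  proof (rule poly_rolle_iterated[of 4 ?x])
    show "?x i < ?x (Suc i)" if "i < 4" for i
      using that z1 z2 by (auto simp: less4)
    show "poly (pderiv G) (?x i) = 0" if "i \<le> 4" for i
      using that z1 z2 G by (auto simp: le4)
  qed simp
  then obtain y :: "nat \<Rightarrow> real" where
    y: "y 0 < y 1" "poly ((pderiv ^^ 3) (pderiv G)) (y 0) = 0"
       "poly ((pderiv ^^ 3) (pderiv G)) (y 1) = 0"
    by auto
  have p: "p = [:coeff p 0, coeff p 1, coeff p 2, coeff p 3, coeff p 4, coeff p 5:]" (is "p = ?p")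
  proof (rule poly_eqI)
    fix i
    show "coeff p i = coeff ?p i"
    proof (cases "i \<le> 5")
      case True
      then have "i = 0 \<or> i = 1 \<or> i = 2 \<or> i = 3 \<or> i = 4 \<or> i = 5" by auto
      then show ?thesis by (auto simp: numeral_eq_Suc)
    next
      case False
      then have "coeff p i = 0" using deg by (simp add: coeff_eq_0)
      moreover have "coeff ?p i = 0"
        using False by (intro coeff_eq_0) (simp add: numeral_eq_Suc)
      ultimately show ?thesis by simp
    qed
  qed
  define C where "C = real k * real (k - 1) * real (k - 2) * real (k - 3)"
  have C: "C > 0" using k by (simp add: C_def)
  \<comment> \<open>The constants \<open>24\<close> and \<open>120\<close> are \<open>4!\<close> and \<open>5!\<close>.\<close>
  have fourth: "poly ((pderiv ^^ 3) (pderiv G)) x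
      = C * x ^ (k - 4) - 24 * coeff p 4 - 120 * coeff p 5 * x" for x
  proof -
    have "(pderiv ^^ 3) (pderiv G) = monom C (k - 4) - [: 24 * coeff p 4, 120 * coeff p 5 :]"
      unfolding G_def
      apply (subst p)
      apply (simp add: numeral_eq_Suc pderiv_diff pderiv_monom pderiv_pCons C_def algebra_simps)
      done
    then show ?thesis by (simp only:) (simp add: poly_monom algebra_simps)
  qed
  have "y 0 ^ (k - 4) < y 1 ^ (k - 4)"
  proof -
    have "odd (k - 4)" using k by auto
    then have "y 0 ^ (k - 4) \<noteq> y 1 ^ (k - 4)"
      using y(1) odd_real_root_power_cancel by (metis less_irrefl)
    moreover have "y 0 ^ (k - 4) \<le> y 1 ^ (k - 4)"
      using \<open>odd (k - 4)\<close> y(1) by (intro power_mono_odd) auto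
    ultimately show ?thesis by simp
  qed
  then have "C * y 0 ^ (k - 4) < C * y 1 ^ (k - 4)"
    using C by simp
  moreover have "coeff p 5 * y 1 \<le> coeff p 5 * y 0"
    using neg y(1) by (simp add: mult_left_mono_neg)
  ultimately show False
    using y(2,3) unfolding fourth by linarith
qed

section \<open>The slopes at three roots\<close>

text \<open>The slope vanishes at a point \<open>y\<close> between \<open>e\<close> and \<open>d\<close> and a point \<open>z\<close> between \<open>d\<close> and \<open>c\<close>.
  It is an increasing function of the absolute value of its argument, so \<open>y = - z\<close>, and \<open>d\<close> lies inside
  \<open>{- z<..<z}\<close> while \<open>c\<close> and \<open>e\<close> lie outside.\<close>

lemma three_roots_slope_signs:
  fixes c d e :: real
  assumes m: "m \<ge> 4" "even m" and ord: "e < d" "d < c"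
    and root: "\<And>x. x \<in> {c, d, e} \<Longrightarrow> x ^ (m - 1) - \<alpha> * x - \<beta> = 0"
  shows "multiplier_slope m \<alpha> c > 0" "multiplier_slope m \<alpha> d < 0" "multiplier_slope m \<alpha> e > 0"
proof -
  let ?g = "\<lambda>x. x ^ (m - 1) - \<alpha> * x - \<beta>"
  have der: "(?g has_real_derivative multiplier_slope m \<alpha> x) (at x)" for x
    unfolding multiplier_slope_def
    by (auto intro!: derivative_eq_intros simp: numeral_2_eq_2)
  have critical: "\<exists>z. a < z \<and> z < b \<and> multiplier_slope m \<alpha> z = 0"
    if ab: "a < b" "a \<in> {c, d, e}" "b \<in> {c, d, e}" for a b
  proof -
    obtain z where z: "a < z" "z < b" "?g b - ?g a = (b - a) * multiplier_slope m \<alpha> z"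
      using MVT2[OF ab(1) der] by blast
    then have "(b - a) * multiplier_slope m \<alpha> z = 0"
      unfolding root[OF ab(2)] root[OF ab(3)] by simp
    then show ?thesis
      using z ab(1) by auto
  qed
  obtain y where y: "e < y" "y < d" "multiplier_slope m \<alpha> y = 0"
    using critical[OF ord(1)] by blast
  obtain z where z: "d < z" "z < c" "multiplier_slope m \<alpha> z = 0"
    using critical[OF ord(2)] by blast
  have "y ^ (m - 2) = z ^ (m - 2)"
  proof -
    have "real (m - 1) * y ^ (m - 2) = real (m - 1) * z ^ (m - 2)"
      using y(3) z(3) unfolding multiplier_slope_def by linarith
    then show ?thesis using m by simp
  qed
  then have "\<bar>y\<bar> ^ (m - 2) = \<bar>z\<bar> ^ (m - 2)"
    using m by (simp add: power_even_abs)
  then have "\<bar>y\<bar> = \<bar>z\<bar>"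
    by (rule power_eq_imp_eq_base) (use m in auto)
  then have yz: "y = - z" "z > 0"
    using y z by auto
  have slope: "multiplier_slope m \<alpha> x = real (m - 1) * (\<bar>x\<bar> ^ (m - 2) - z ^ (m - 2))" for x
    using z(3) m by (simp add: multiplier_slope_def power_even_abs algebra_simps)
  show "multiplier_slope m \<alpha> c > 0" "multiplier_slope m \<alpha> e > 0"
  proof -
    have outside: "multiplier_slope m \<alpha> x > 0" if "z < \<bar>x\<bar>" for x
      unfolding slope using that yz m by (auto intro!: mult_pos_pos power_strict_mono)
    show "multiplier_slope m \<alpha> c > 0" "multiplier_slope m \<alpha> e > 0"
      using yz y(1) z(2) by (auto intro!: outside)
  qed
  have "\<bar>d\<bar> ^ (m - 2) < z ^ (m - 2)"
    using yz y z m by (intro power_strict_mono) auto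
  then show "multiplier_slope m \<alpha> d < 0"
    unfolding slope using m by (simp add: mult_less_0_iff)
qed

text \<open>With \<open>w = (x - c) (x - d) (x - e)\<close>, the Hermite interpolant of \<open>x ^ (m - 1)\<close> is the line
  \<open>\<alpha> * x + \<beta>\<close> plus \<open>w * r\<close>, where \<open>r\<close> is the quadratic taking the value
  \<open>multiplier_slope m \<alpha> x / w' x\<close> at each root \<open>x\<close>. Its leading coefficient is that of \<open>r\<close>, and
  multiplied by the square of \<open>(c - d) (d - e) (c - e)\<close> it becomes the form in question.\<close>

lemma three_roots_slope_form_pos:
  fixes c d e :: real
  assumes m: "m \<ge> 6" "even m" and ord: "e < d" "d < c"
    and root: "\<And>x. x \<in> {c, d, e} \<Longrightarrow> x ^ (m - 1) - \<alpha> * x - \<beta> = 0"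
  shows "multiplier_slope m \<alpha> c * (d - e)\<^sup>2 + multiplier_slope m \<alpha> d * (c - e)\<^sup>2
    + multiplier_slope m \<alpha> e * (c - d)\<^sup>2 > 0"
proof -
  define A B E where ABE: "A = multiplier_slope m \<alpha> c"
    "B = multiplier_slope m \<alpha> d" "E = multiplier_slope m \<alpha> e"
  \<comment> \<open>\<open>r\<close> is written in Newton form, so that its leading coefficient \<open>K\<close> is a divided difference
    of the prescribed values \<open>rc\<close>, \<open>rd\<close>, \<open>re\<close>.\<close>
  define rc where "rc = A / ((c - d) * (c - e))"
  define rd where "rd = - B / ((c - d) * (d - e))"
  define re where "re = E / ((c - e) * (d - e))"
  define K1 where "K1 = (rc - rd) / (c - d)"
  define K where "K = (K1 - (rd - re) / (d - e)) / (c - e)"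
  define r where "r = [:rc:] + smult K1 [:-c, 1:] + smult K ([:-c, 1:] * [:-d, 1:])"
  define w where "w = [:-c, 1:] * [:-d, 1:] * [:-e, 1:]"
  define p where "p = [:\<beta>, \<alpha>:] + w * r"
  have r: "poly r c = rc" "poly r d = rd" "poly r e = re"
  proof -
    have K1: "K1 * (c - d) = rc - rd" and K: "K * (c - e) = K1 - (rd - re) / (d - e)"
      using ord by (simp_all add: K1_def K_def)
    have r_newton: "poly r x = rc + K1 * (x - c) + K * (c - x) * (d - x)" for x
      by (simp add: r_def algebra_simps)
    show "poly r c = rc" by (simp add: r_newton)
    show "poly r d = rd" using K1 by (simp add: r_newton algebra_simps)
    have "K * (c - e) * (d - e) = K1 * (d - e) - (rd - re)"
      unfolding K using ord by (simp add: field_simps)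
    then show "poly r e = re" using K1 by (simp add: r_newton algebra_simps)
  qed
  have w: "poly w c = 0" "poly w d = 0" "poly w e = 0"
    unfolding w_def poly_mult by simp_all
  have w': "poly (pderiv w) c = (c - d) * (c - e)" "poly (pderiv w) d = - ((c - d) * (d - e))"
     "poly (pderiv w) e = (c - e) * (d - e)"
  proof -
    have w'_product: "poly (pderiv w) x
        = (x - d) * (x - e) + (x - c) * (x - e) + (x - c) * (x - d)" for x
      by (simp add: w_def pderiv_mult pderiv_pCons algebra_simps)
    show "poly (pderiv w) c = (c - d) * (c - e)" "poly (pderiv w) d = - ((c - d) * (d - e))"
      "poly (pderiv w) e = (c - e) * (d - e)"
      unfolding w'_product by (simp_all add: algebra_simps)
  qed
  have "coeff p 5 > 0"
  proof (rule quintic_hermite_lead_coeff_pos[of "m - 1" e d c])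
    show "odd (m - 1)" "m - 1 \<ge> 5" using m by auto
    have "degree w \<le> 3" "degree r \<le> 2"
      by (simp_all add: w_def r_def)
    then show "degree p \<le> 5"
      unfolding p_def
      by (intro degree_add_le) (use degree_mult_le[of w r] in auto)
    show "poly p x = x ^ (m - 1)" if "x \<in> {c, d, e}" for x
      using root[OF that] that w by (auto simp: p_def algebra_simps)
    show "poly (pderiv p) x = real (m - 1) * x ^ (m - 1 - 1)" if "x \<in> {c, d, e}" for x
    proof -
      have "poly (pderiv p) x = \<alpha> + poly (pderiv w) x * poly r x"
        using that w by (auto simp: p_def pderiv_add pderiv_mult pderiv_pCons)
      also have "\<dots> = \<alpha> + multiplier_slope m \<alpha> x"
        using that ord r w' by (auto simp: rc_def rd_def re_def ABE)
      finally show ?thesis by (simp add: multiplier_slope_def numeral_2_eq_2)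
    qed
  qed (use ord in auto)
  moreover have "coeff p 5 = K"
    by (simp add: p_def w_def r_def numeral_eq_Suc)
  ultimately have "K > 0" by simp
  moreover have "K * ((c - d) * (d - e) * (c - e))\<^sup>2
      = A * (d - e)\<^sup>2 + B * (c - e)\<^sup>2 + E * (c - d)\<^sup>2"
  proof -
    define a b where "a = c - d" "b = d - e"
    have ab: "a > 0" "b > 0" "c - d = a" "d - e = b" "c - e = a + b"
      using ord by (auto simp: a_b_def)
    show ?thesis
      unfolding K_def K1_def rc_def rd_def re_def ab
      using ab(1,2) by (simp add: divide_simps) (auto simp: algebra_simps power2_eq_square)
  qed
  moreover have "((c - d) * (d - e) * (c - e))\<^sup>2 > 0"
    using ord by simp
  ultimately show ?thesis
    unfolding ABE by (metis mult_pos_pos)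
qed

section \<open>Points with three values\<close>

lemma card_block_vector_values:
  fixes idx :: "'n::finite \<Rightarrow> nat" and P :: "real ^ 'n ^ 'n"
  assumes bij: "bij_betw idx UNIV {1..p + q + s}" and perm: "permutation_matrix P"
    and ord: "e < d" "d < c" and u: "u = P *v block_vector idx p q c d e"
  shows "card {i. u $ i = c} = p" "card {i. u $ i = d} = q" "card {i. u $ i = e} = s"
    "range (($) u) \<subseteq> {c, d, e}"
proof -
  let ?b = "block_vector idx p q c d e"
  obtain \<pi> where \<pi>: "\<pi> permutes UNIV" and P: "P = (\<chi> i j. if i = \<pi> j then 1 else 0)"
    using perm by (auto simp: permutation_matrix_def)
  have u\<pi>: "u $ (\<pi> j) = ?b $ j" for j
  proof -
    have "u $ (\<pi> j) = (\<Sum>k\<in>UNIV. (if \<pi> j = \<pi> k then 1 else 0) * ?b $ k)"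
      by (simp add: u P matrix_vector_mult_def)
    also have "\<dots> = (\<Sum>k\<in>UNIV. if k = j then ?b $ k else 0)"
      using permutes_inj[OF \<pi>] by (intro sum.cong) (auto simp: inj_eq)
    finally show ?thesis by simp
  qed
  have surj: "\<exists>j. i = \<pi> j" for i
    using permutes_surj[OF \<pi>] by (auto simp: surj_def)
  have card_val: "card {i. u $ i = x} = card {k \<in> {1..p + q + s}.
      (if k \<le> p then c else if k \<le> p + q then d else e) = x}" (is "_ = card ?K") for x
  proof -
    have "card {j. ?b $ j = x} = card {i. u $ i = x}"
    proof (rule bij_betw_same_card)
      show "bij_betw \<pi> {j. ?b $ j = x} {i. u $ i = x}"
      using permutes_inj[OF \<pi>] surj
      by (auto simp: bij_betw_def inj_on_def inj_def u\<pi> image_iff) (metis u\<pi>)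
    qed
    moreover have "card {j. ?b $ j = x} = card ?K"
    proof (rule bij_betw_same_card[OF bij_betw_subset[OF bij]])
      define V where "V k = (if k \<le> p then c else if k \<le> p + q then d else e)" for k
      have "idx ` {j. V (idx j) = x} = {k \<in> range idx. V k = x}"
        by auto
      also have "range idx = {1..p + q + s}"
        using bij by (rule bij_betw_imp_surj_on)
      finally show "idx ` {j. ?b $ j = x} = ?K"
        unfolding block_vector_def V_def by simp
    qed simp
    ultimately show ?thesis by simp
  qed
  have "{k \<in> {1..p + q + s}. (if k \<le> p then c else if k \<le> p + q then d else e) = c} = {1..p}"
    "{k \<in> {1..p + q + s}. (if k \<le> p then c else if k \<le> p + q then d else e) = d} = {p + 1..p + q}"
    "{k \<in> {1..p + q + s}. (if k \<le> p then c else if k \<le> p + q then d else e) = e}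
      = {p + q + 1..p + q + s}"
    using ord by auto
  then show "card {i. u $ i = c} = p" "card {i. u $ i = d} = q" "card {i. u $ i = e} = s"
    unfolding card_val by simp_all
  show "range (($) u) \<subseteq> {c, d, e}"
  proof
    fix y assume "y \<in> range (($) u)"
    then obtain j where "y = u $ \<pi> j" using surj by (metis imageE)
    then show "y \<in> {c, d, e}"
      unfolding u\<pi> by (auto simp: block_vector_def)
  qed
qed

lemma sum_three_values:
  fixes u :: "real ^ 'n::finite" and F :: "real \<Rightarrow> real"
  assumes "range (($) u) \<subseteq> {c, d, e}" "c \<noteq> d" "d \<noteq> e" "c \<noteq> e"
  shows "(\<Sum>i\<in>UNIV. F (u $ i)) = real (card {i. u $ i = c}) * F c
    + real (card {i. u $ i = d}) * F d + real (card {i. u $ i = e}) * F e"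
proof -
  have "(\<Sum>i\<in>UNIV. F (u $ i)) = (\<Sum>y\<in>{c, d, e}. \<Sum>i\<in>{i \<in> UNIV. u $ i = y}. F (u $ i))"
    using assms(1) by (intro sum.group[symmetric]) auto
  also have "\<dots> = (\<Sum>y\<in>{c, d, e}. real (card {i. u $ i = y}) * F y)"
    by (intro sum.cong) auto
  finally show ?thesis using assms by simp
qed

lemma attained_value_root:
  fixes u :: "real ^ 'n::finite"
  assumes stat: "\<And>i. (u $ i) ^ (m - 1) - \<alpha> * u $ i - \<beta> = 0"
    and card: "card {i. u $ i = x} \<ge> 1"
  shows "x ^ (m - 1) - \<alpha> * x - \<beta> = 0"
proof -
  have "{i. u $ i = x} \<noteq> {}"
    using card by (metis card.empty not_one_le_zero)
  then show ?thesis using stat by auto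
qed

text \<open>The direction \<open>v\<close> equals \<open>d - e\<close>, \<open>- (c - e) / q\<close>, \<open>c - d\<close> on the three blocks: up to scaling, the
  only tangent vector constant on each block. For \<open>m \<ge> 6\<close> the form is at least the one
  for \<open>q = 1\<close>, which is positive. For \<open>m = 4\<close> the latter is zero, and \<open>q \<ge> 2\<close> makes the comparison
  strict.\<close>

lemma simple_extremes_not_local_max:
  fixes u :: "real ^ 'n::finite"
  assumes feas: "u \<in> feasible" and m: "m \<ge> 4" "even m"
    and stat: "\<And>i. (u $ i) ^ (m - 1) - \<alpha> * u $ i - \<beta> = 0"
    and ord: "e < d" "d < c" and range: "range (($) u) \<subseteq> {c, d, e}"
    and card: "card {i. u $ i = c} = 1" "card {i. u $ i = d} = q" "card {i. u $ i = e} = 1"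
    and q: "q \<ge> 1" and nondeg: "q \<noteq> 1 \<or> m \<noteq> 4"
  shows "\<not> local_max_on feasible (objective m) u"
proof -
  have root: "x ^ (m - 1) - \<alpha> * x - \<beta> = 0" if x: "x \<in> {c, d, e}" for x
  proof (rule attained_value_root[OF stat])
    show "card {i. u $ i = x} \<ge> 1" using x card q by auto
  qed
  define A B E where ABE: "A = multiplier_slope m \<alpha> c"
    "B = multiplier_slope m \<alpha> d" "E = multiplier_slope m \<alpha> e"
  have B: "B < 0"
    using three_roots_slope_signs[OF m ord root] by (simp add: ABE)
  define h where "h x = (if x = c then d - e else if x = d then - (c - e) / real q else c - d)" for x
  have h: "h c = d - e" "h d = - (c - e) / real q" "h e = c - d"
    using ord by (auto simp: h_def)
  define v :: "real ^ 'n" where "v = (\<chi> i. h (u $ i))"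
  have sumF: "(\<Sum>i\<in>UNIV. F (u $ i)) = F c + real q * F d + F e" for F :: "real \<Rightarrow> real"
    using sum_three_values[OF range, of F] ord card by simp
  have vu: "v \<bullet> u = 0"
    using sumF[of "\<lambda>x. h x * x"] q by (simp add: v_def inner_vec_def h) (simp add: algebra_simps)
  have v1: "v \<bullet> vec 1 = 0"
    using sumF[of h] q by (simp add: v_def inner_vec_def h)
  have Q: "A * (d - e)\<^sup>2 + B * (c - e)\<^sup>2 / real q + E * (c - d)\<^sup>2
      = (\<Sum>i\<in>UNIV. multiplier_slope m \<alpha> (u $ i) * (v $ i)\<^sup>2)"
  proof -
    have "real q * (B * (- (c - e) / real q)\<^sup>2) = B * (c - e)\<^sup>2 / real q"
      using q by (simp add: power2_eq_square field_simps)
    then show ?thesis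
      using sumF[of "\<lambda>x. multiplier_slope m \<alpha> x * (h x)\<^sup>2"] unfolding v_def h ABE by simp
  qed
  have B_le: "B * (c - e)\<^sup>2 \<le> B * (c - e)\<^sup>2 / real q"
  proof -
    have "(c - e)\<^sup>2 / real q \<le> (c - e)\<^sup>2 / 1"
      using q by (intro divide_left_mono) auto
    then have "B * ((c - e)\<^sup>2 / 1) \<le> B * ((c - e)\<^sup>2 / real q)"
      using B by (intro mult_left_mono_neg) auto
    then show ?thesis by simp
  qed
  have "A * (d - e)\<^sup>2 + B * (c - e)\<^sup>2 / real q + E * (c - d)\<^sup>2 > 0"
  proof (cases "m = 4")
    case False
    then have "m \<ge> 6" using m by (auto elim!: evenE)
    then show ?thesis
      using three_roots_slope_form_pos[OF _ m(2) ord root] B_le unfolding ABE by force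
  next
    case True
    then have q2: "q \<ge> 2" using q nondeg by simp
    have c3: "c ^ 3 = \<alpha> * c + \<beta>" and d3: "d ^ 3 = \<alpha> * d + \<beta>" and e3: "e ^ 3 = \<alpha> * e + \<beta>"
      using root True by (auto simp: algebra_simps)
    have "(c - d) * (c\<^sup>2 + c * d + d\<^sup>2 - \<alpha>) = 0" "(d - e) * (d\<^sup>2 + d * e + e\<^sup>2 - \<alpha>) = 0"
      using c3 d3 e3 by (simp_all add: algebra_simps power2_eq_square power3_eq_cube)
    then have \<alpha>: "\<alpha> = c\<^sup>2 + c * d + d\<^sup>2" "\<alpha> = d\<^sup>2 + d * e + e\<^sup>2"
      using ord by auto
    then have "(c - e) * (c + d + e) = 0"
      by (simp add: algebra_simps power2_eq_square)
    \<comment> \<open>The cubic \<open>x ^ 3 - \<alpha> * x - \<beta>\<close> has no quadratic term, so its roots sum to zero.\<close>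
    then have e: "e = - c - d" using ord by auto
    have form: "A * (d - e)\<^sup>2 + B * (c - e)\<^sup>2 + E * (c - d)\<^sup>2 = 0"
      unfolding ABE multiplier_slope_def True \<alpha>(1) e
      by (simp add: algebra_simps power2_eq_square)
    have "(c - e)\<^sup>2 / real q < (c - e)\<^sup>2"
      using q2 ord by (simp add: field_simps)
    then have "B * (c - e)\<^sup>2 < B * ((c - e)\<^sup>2 / real q)"
      using B by (rule mult_strict_left_mono_neg)
    then show ?thesis using form by simp
  qed
  then show ?thesis
    using second_order_test(1)[OF feas _ m(2) stat vu v1 Q] m by simp
qed

theorem lemma5:
  fixes n m p q s :: nat
    and c d e :: real
    and idx :: "'n::finite \<Rightarrow> nat"
    and P :: "real ^ 'n ^ 'n"
    and u :: "real ^ 'n"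
  assumes "CARD('n) = n" and "n \<ge> 3"
    and "m \<ge> 4" and "even m"
    and "(n, m) \<noteq> (3, 4)"
    and "bij_betw idx UNIV {1..n}"
    and "permutation_matrix P"
    and "p \<in> {1..n - 1}" and "q \<in> {1..n - 1}" and "s \<in> {1..n - 1}"
    and "p + q + s = n"
    and "e < d" and "d < c"
    and "u = P *v block_vector idx p q c d e"
    and "stationary_point m u"
  shows "(q \<noteq> 1 \<longrightarrow> saddle_point m u) \<and>
         (q = 1 \<longrightarrow> \<not> local_max_on feasible (objective m) u)"
proof -
  note m = \<open>m \<ge> 4\<close> \<open>even m\<close> and ord = \<open>e < d\<close> \<open>d < c\<close>
  have pqs: "p \<ge> 1" "q \<ge> 1" "s \<ge> 1"
    using \<open>p \<in> _\<close> \<open>q \<in> _\<close> \<open>s \<in> _\<close> by auto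
  obtain \<alpha> \<beta> where feas: "u \<in> feasible"
    and stat: "\<And>i. (u $ i) ^ (m - 1) - \<alpha> * u $ i - \<beta> = 0"
    using \<open>stationary_point m u\<close> by (auto simp: stationary_point_def)
  have "bij_betw idx UNIV {1..p + q + s}"
    using \<open>bij_betw idx UNIV {1..n}\<close> \<open>p + q + s = n\<close> by simp
  note attained = card_block_vector_values[OF this \<open>permutation_matrix P\<close> ord
      \<open>u = P *v block_vector idx p q c d e\<close>]
  have root: "x ^ (m - 1) - \<alpha> * x - \<beta> = 0" if x: "x \<in> {c, d, e}" for x
  proof (rule attained_value_root[OF stat])
    show "card {i. u $ i = x} \<ge> 1" using x attained pqs by auto
  qed
  note signs = three_roots_slope_signs[OF m ord root]
  have m2: "m \<ge> 2" using m by simp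
  note repeated = repeated_value_test[OF feas m2 m(2) stat]
  have "\<not> local_max_on feasible (objective m) u"
  proof (cases "p = 1 \<and> s = 1")
    case True
    then have "q \<noteq> 1 \<or> m \<noteq> 4"
      using \<open>(n, m) \<noteq> (3, 4)\<close> \<open>p + q + s = n\<close> by auto
    with True attained pqs show ?thesis
      by (intro simple_extremes_not_local_max[OF feas m stat ord]) auto
  next
    case False
    then have "card {i. u $ i = c} \<ge> 2 \<or> card {i. u $ i = e} \<ge> 2"
      using attained pqs by auto
    then show ?thesis
      using repeated(1) signs by blast
  qed
  moreover have "\<not> local_min_on feasible (objective m) u" if "q \<noteq> 1"
    using repeated(2)[of d] signs(2) attained(2) pqs that by simp
  ultimately show ?thesis
    using \<open>stationary_point m u\<close> by (auto simp: saddle_point_def)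
qed

end
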